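(* Let $\mathcal H$ be a real Hilbert space, $t_0>0$, let $f\in\mathcal C^2(\mathcal H)$ be convex with nonempty set of minimizers, and let $e\in\mathcal C^1([t_0,+\infty[;\mathcal H)$ with $\int_{t_0}^{+\infty}t\|e(t)\|dt<+\infty$ and $\int_{t_0}^{+\infty}t\|\dot e(t)\|dt<+\infty$. Let $\alpha>3$, $\beta>0$, and let $x$ be a solution trajectory of $$\ddot x(t)+\frac{\alpha}{t}\dot x(t)+\beta\frac{d}{dt}\big(\nabla f(x(t))+e(t)\big)+\nabla f(x(t))+e(t)=0.$$ Then $x(t)$ converges weakly, as $t\to+\infty$, to a minimizer of $f$. *)

theory Defs
  imports "HOL-Analysis.Analysis"
begin

definition weakly_tendsto :: "('b \<Rightarrow> 'a::real_inner) \<Rightarrow> 'a \<Rightarrow> 'b filter \<Rightarrow> bool" where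
  "weakly_tendsto x l F \<longleftrightarrow> (\<forall>v. ((\<lambda>t. inner (x t) v) \<longlongrightarrow> inner l v) F)"

end

theory Submission
  imports Defs
begin

text \<open>
  Write \<open>g = \<nabla>f(x) + e\<close> and let \<open>z\<close> be a minimiser. For \<open>2 < \<lambda> < \<alpha> - 1\<close> and
  \<open>u = \<lambda>(x - z) + t(x' + \<beta>g)\<close>, the energy
  \<open>E = (t\<^sup>2 + (\<alpha> - 2 - \<lambda>)\<beta>t)(f(x) - min f) + \<bar>u\<bar>\<^sup>2/2 + \<lambda>(\<alpha> - 1 - \<lambda>)\<bar>x - z\<bar>\<^sup>2/2\<close> satisfies, for large \<open>t\<close>,
  \<open>E' \<le> - D + K t\<bar>e\<bar>(1 + E)\<close>, where \<open>D\<close> controls \<open>t\<langle>\<nabla>f(x), x - z\<rangle>\<close>, \<open>t\<bar>x'\<bar>\<^sup>2\<close> and \<open>t\<^sup>2\<bar>g\<bar>\<^sup>2\<close>; the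
  integrability of \<open>t\<bar>e'\<bar>\<close> enters through the boundedness of \<open>t\<bar>e\<bar>\<close>. By Gronwall, \<open>E\<close> is bounded and \<open>D\<close>
  is integrable. Hence \<open>f(x(t)) \<rightarrow> min f\<close>, and the second-order equation for \<open>\<bar>x - z\<bar>\<^sup>2/2\<close> shows that
  \<open>\<bar>x(t) - z\<bar>\<close> converges for every minimiser \<open>z\<close>. Opial's argument then yields weak convergence; weak
  compactness is replaced by the fact that decreasing bounded closed convex sets in a Hilbert space
  have a common point.
\<close>

subsection \<open>Opial's argument\<close>

text \<open>Almost norm-minimal points of the sets form a Cauchy sequence by the parallelogram law,
  because the squared minimal norms \<open>d n\<close> increase and are bounded. The limit stays in
  every \<open>K n\<close>. This is the compactness behind both the weak cluster point and the
  asymptotic centre.\<close>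

lemma nested_closed_convex_Inter_nonempty:
  fixes K :: "nat \<Rightarrow> 'a::{real_inner, complete_space} set"
  assumes cl: "\<And>n. closed (K n)" and cv: "\<And>n. convex (K n)" and ne: "\<And>n. K n \<noteq> {}"
    and dec: "\<And>m n. m \<le> n \<Longrightarrow> K n \<subseteq> K m" and bd: "bounded (K 0)"
  shows "\<exists>y. \<forall>n. y \<in> K n"
proof -
  obtain B where B: "\<And>y. y \<in> K 0 \<Longrightarrow> norm y \<le> B"
    using bd by (auto simp: bounded_iff)
  define d where "d n = (INF y\<in>K n. (norm y)\<^sup>2)" for n
  have bb: "bdd_below ((\<lambda>y. (norm y)\<^sup>2) ` K n)" for n
    by (rule bdd_belowI2[of _ 0]) simp
  have d_le: "d n \<le> (norm y)\<^sup>2" if "y \<in> K n" for n y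
    unfolding d_def using bb that by (rule cINF_lower)
  have "\<exists>y\<in>K n. (norm y)\<^sup>2 < d n + 1 / real (Suc n)" for n
  proof (rule ccontr)
    assume "\<not> ?thesis"
    then have "d n + 1 / real (Suc n) \<le> d n"
      unfolding d_def[of n] by (intro cINF_greatest ne) (auto simp: not_less d_def)
    then show False by simp
  qed
  then obtain y where yK: "\<And>n. y n \<in> K n"
    and yd: "\<And>n. (norm (y n))\<^sup>2 < d n + 1 / real (Suc n)" by metis
  have dmono: "d m \<le> d n" if "m \<le> n" for m n
    unfolding d_def[of n] using d_le dec[OF that] by (intro cINF_greatest ne) auto
  have "d n \<le> B\<^sup>2" for n
  proof -
    have "y n \<in> K 0" using yK dec by blast
    then have "(norm (y n))\<^sup>2 \<le> B\<^sup>2" using B by (intro power_mono) auto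
    then show ?thesis using d_le[OF yK] by (meson order_trans)
  qed
  then have "convergent d"
    using dmono by (intro Bseq_mono_convergent BseqI'[of _ "\<bar>d 0\<bar> + B\<^sup>2"])
      (smt (verit) le0 real_norm_def zero_le_power2)+
  then have dC: "Cauchy d" by (rule convergent_Cauchy)
  \<comment> \<open>The midpoint of \<open>y n\<close> and \<open>y m\<close> still lies in the
    larger set \<open>K n\<close>, so its squared norm is at least \<open>d n\<close>; the
    parallelogram law turns this into an upper bound for the difference.\<close>
  have key: "(norm (y n - y m))\<^sup>2 \<le> 2 * (d m - d n) + 4 / real (Suc n)" if "n \<le> m" for n m
  proof -
    have "y m \<in> K n" using yK dec[OF that] by blast
    then have "(1/2) *\<^sub>R y n + (1/2) *\<^sub>R y m \<in> K n"
      using cv[of n] yK[of n] by (intro convexD) auto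
    then have "d n \<le> (norm ((1/2) *\<^sub>R y n + (1/2) *\<^sub>R y m))\<^sup>2" by (rule d_le)
    also have "\<dots> = (1/4) * (norm (y n + y m))\<^sup>2"
      by (simp add: scaleR_add_right[symmetric] power_mult_distrib power2_eq_square)
    finally have 1: "4 * d n \<le> (norm (y n + y m))\<^sup>2" by simp
    have 2: "(norm (y n - y m))\<^sup>2 + (norm (y n + y m))\<^sup>2 = 2 * (norm (y n))\<^sup>2 + 2 * (norm (y m))\<^sup>2"
      by (simp add: power2_norm_eq_inner inner_simps inner_commute)
    have 3: "1 / real (Suc m) \<le> 1 / real (Suc n)"
      using that by (simp add: frac_le)
    show ?thesis using 1 2 3 yd[of n] yd[of m] by simp
  qed
  have "Cauchy y"
  proof (rule metric_CauchyI)
    fix \<epsilon> :: real assume \<epsilon>: "\<epsilon> > 0"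
    obtain M where M: "\<And>m n. M \<le> m \<Longrightarrow> M \<le> n \<Longrightarrow> dist (d m) (d n) < \<epsilon>\<^sup>2 / 4"
      using dC \<epsilon> unfolding Cauchy_def by (metis zero_less_divide_iff zero_less_numeral zero_less_power)
    \<comment> \<open>The two terms of \<open>key\<close> each have to stay below
      \<open>\<epsilon>\<^sup>2 / 2\<close>: \<open>M\<close> takes care of the first,
      \<open>N\<close> of the second.\<close>
    obtain N where N: "8 / \<epsilon>\<^sup>2 < real N" using reals_Archimedean2 by blast
    have small: "norm (y n - y m) < \<epsilon>" if "n \<le> m" "max M N \<le> n" for n m
    proof -
      have "8 / \<epsilon>\<^sup>2 < real (Suc n)" using N that by linarith
      then have "4 / real (Suc n) < \<epsilon>\<^sup>2 / 2" using \<epsilon> by (simp add: field_simps)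
      moreover have "d m - d n < \<epsilon>\<^sup>2 / 4" using M[of m n] that unfolding dist_real_def by linarith
      ultimately have "(norm (y n - y m))\<^sup>2 < \<epsilon>\<^sup>2" using key[OF that(1)] by simp
      then show ?thesis using \<epsilon> by (meson less_imp_le power_less_imp_less_base)
    qed
    show "\<exists>M. \<forall>m\<ge>M. \<forall>n\<ge>M. dist (y m) (y n) < \<epsilon>"
    proof (intro exI[of _ "max M N"] allI impI)
      fix m n assume "max M N \<le> m" "max M N \<le> n"
      then show "dist (y m) (y n) < \<epsilon>"
        using small[of m n] small[of n m] linear[of m n] by (auto simp: dist_norm norm_minus_commute)
    qed
  qed
  then obtain l where l: "y \<longlonglongrightarrow> l" using Cauchy_convergent convergent_def by blast
  have "l \<in> K n" for n
  proof (rule Lim_in_closed_set[OF cl _ _ l])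
    show "eventually (\<lambda>k. y k \<in> K n) sequentially"
      using eventually_ge_at_top[of n] by eventually_elim (use yK dec in blast)
  qed simp
  then show ?thesis by blast
qed

text \<open>The point \<open>y\<close> acts as a weak cluster point of \<open>x\<close> along the
  times where \<open>Q\<close> holds. Weak closedness is tested on closed convex sets only, so it
  suffices to take a common point of the closed convex hulls of the tails.\<close>

lemma weak_cluster_point:
  fixes x :: "real \<Rightarrow> 'a::{real_inner, complete_space}"
  assumes bd: "eventually (\<lambda>t. norm (x t) \<le> B) at_top"
    and fr: "frequently Q at_top"
  shows "\<exists>y. \<forall>C. closed C \<longrightarrow> convex C \<longrightarrow> eventually (\<lambda>t. Q t \<longrightarrow> x t \<in> C) at_top \<longrightarrow> y \<in> C"
proof -
  obtain T where T: "\<And>t. t \<ge> T \<Longrightarrow> norm (x t) \<le> B"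
    using bd by (auto simp: eventually_at_top_linorder)
  \<comment> \<open>The tails start at \<open>T\<close>, from where the bound \<open>B\<close> is in
    force, so that already \<open>K 0\<close> is bounded.\<close>
  define K where "K n = closure (convex hull (x ` {t. t \<ge> T + real n \<and> Q t}))" for n :: nat
  have K_subset: "K n \<subseteq> C" if "closed C" "convex C" "\<And>t. t \<ge> T + real n \<Longrightarrow> Q t \<Longrightarrow> x t \<in> C" for n C
    unfolding K_def by (intro closure_minimal hull_minimal that) (use that in auto)
  have "\<exists>y. \<forall>n. y \<in> K n"
  proof (rule nested_closed_convex_Inter_nonempty)
    fix n
    show "closed (K n)" "convex (K n)" by (simp_all add: K_def convex_closure)
    obtain t where "t \<ge> T + real n" "Q t"
      using fr by (force simp: frequently_def eventually_at_top_linorder)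
    then show "K n \<noteq> {}" unfolding K_def by auto
  next
    fix m n :: nat assume "m \<le> n"
    then show "K n \<subseteq> K m"
      unfolding K_def by (intro closure_mono hull_mono image_mono) auto
  next
    have "K 0 \<subseteq> cball 0 B" by (rule K_subset) (auto intro: T)
    then show "bounded (K 0)" using bounded_cball bounded_subset by blast
  qed
  then obtain y where y: "\<And>n. y \<in> K n" by blast
  have "y \<in> C" if C: "closed C" "convex C" "eventually (\<lambda>t. Q t \<longrightarrow> x t \<in> C) at_top" for C
  proof -
    obtain U where U: "\<And>t. t \<ge> U \<Longrightarrow> Q t \<Longrightarrow> x t \<in> C"
      using C(3) by (auto simp: eventually_at_top_linorder)
    obtain n where "U - T \<le> real n" using real_arch_simple by blast
    then have "K n \<subseteq> C" by (intro K_subset C U) auto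
    then show ?thesis using y by blast
  qed
  then show ?thesis by blast
qed

text \<open>The weak limit is found as the asymptotic centre of the trajectory: the minimiser over the
  minimisers \<open>z\<close> of \<open>f\<close> of the limit of \<open>norm (x t - z)\<close>.\<close>

lemma opial_convex_minimizers:
  fixes x :: "real \<Rightarrow> 'a::{real_inner, complete_space}" and f :: "'a \<Rightarrow> real"
  assumes cont: "continuous_on UNIV f" and conv: "convex_on UNIV f"
    and z0: "\<forall>y. f z0 \<le> f y"
    and lim: "\<And>z. \<forall>y. f z \<le> f y \<Longrightarrow> \<exists>L. ((\<lambda>t. norm (x t - z)) \<longlongrightarrow> L) at_top"
    and val: "((\<lambda>t. f (x t)) \<longlongrightarrow> f z0) at_top"
  shows "\<exists>z. (\<forall>y. f z \<le> f y) \<and> weakly_tendsto x z at_top"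
proof -
  have sub_closed: "closed {z. f z \<le> a}" for a
    using cont by (intro closed_Collect_le) auto
  have sub_convex: "convex {z. f z \<le> a}" for a
  proof (rule convexI)
    fix p q :: 'a and s r :: real
    assume "p \<in> {z. f z \<le> a}" "q \<in> {z. f z \<le> a}" "0 \<le> s" "0 \<le> r" "s + r = 1"
    moreover from this have "f (s *\<^sub>R p + r *\<^sub>R q) \<le> s * f p + r * f q"
      using conv by (auto simp: convex_on_def)
    moreover have "s * f p + r * f q \<le> a"
      using calculation by (intro convex_bound_le) auto
    ultimately show "s *\<^sub>R p + r *\<^sub>R q \<in> {z. f z \<le> a}" by simp
  qed
  have S_iff: "(\<forall>y. f z \<le> f y) \<longleftrightarrow> f z \<le> f z0" for z
    using z0 order_trans by blast
  define S where "S = {z. f z \<le> f z0}"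
  obtain N where N: "\<And>z. z \<in> S \<Longrightarrow> ((\<lambda>t. norm (x t - z)) \<longlongrightarrow> N z) at_top"
    using lim unfolding S_iff S_def mem_Collect_eq by metis
  have z0S: "z0 \<in> S" by (simp add: S_def)
  have N_lip: "N a \<le> N b + norm (a - b)" if "a \<in> S" "b \<in> S" for a b
  proof (rule tendsto_le[OF _ tendsto_add[OF N[OF that(2)] tendsto_const] N[OF that(1)]])
    show "eventually (\<lambda>t. norm (x t - a) \<le> norm (x t - b) + norm (a - b)) at_top"
      by (intro always_eventually allI) norm
  qed simp
  have N_nonneg: "0 \<le> N a" if "a \<in> S" for a
    by (rule tendsto_lowerbound[OF N[OF that]]) auto
  define m where "m = (INF z\<in>S. N z)"
  have bb: "bdd_below (N ` S)" using N_nonneg by (rule bdd_belowI2)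
  have m_le: "m \<le> N z" if "z \<in> S" for z
    unfolding m_def using bb that by (rule cINF_lower)
  \<comment> \<open>These sets of near-minimisers of \<open>N\<close> are closed since
    \<open>N\<close> is nonexpansive, convex since \<open>N\<close> is a limit of convex functions,
    and bounded since two points are no farther apart than the sum of their distances to
    \<open>x t\<close>. A common point minimises \<open>N\<close> over \<open>S\<close>.\<close>
  define K where "K n = {z \<in> S. N z \<le> m + 1 / real (Suc n)}" for n
  have "\<exists>z. \<forall>n. z \<in> K n"
  proof (rule nested_closed_convex_Inter_nonempty)
    fix n
    show "closed (K n)"
    unfolding closed_sequential_limits
    proof (intro allI impI)
      fix y l assume yl: "(\<forall>k. y k \<in> K n) \<and> y \<longlonglongrightarrow> l"
      have lS: "l \<in> S"
        using yl sub_closed[of "f z0"] unfolding K_def S_def closed_sequential_limits by blast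
      have "(\<lambda>k. m + 1 / real (Suc n) + norm (l - y k)) \<longlonglongrightarrow> m + 1 / real (Suc n) + norm (l - l)"
        using yl by (intro tendsto_intros) auto
      moreover have "N l \<le> m + 1 / real (Suc n) + norm (l - y k)" for k
        using N_lip[OF lS, of "y k"] yl[THEN conjunct1, rule_format, of k] by (simp add: K_def)
      ultimately have "N l \<le> m + 1 / real (Suc n) + norm (l - l)"
        by (intro LIMSEQ_le_const) auto
      then show "l \<in> K n" using lS by (simp add: K_def)
    qed
    show "convex (K n)"
    proof (rule convexI)
      fix a b :: 'a and s r :: real
      assume ab: "a \<in> K n" "b \<in> K n" and sr: "0 \<le> s" "0 \<le> r" "s + r = 1"
      have "s *\<^sub>R a + r *\<^sub>R b \<in> S"
        using ab sr sub_convex[of "f z0"] unfolding K_def S_def[symmetric] by (intro convexD) auto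
      moreover have "N (s *\<^sub>R a + r *\<^sub>R b) \<le> s * N a + r * N b"
      proof (rule tendsto_le[OF _ _ N[OF calculation]])
        show "((\<lambda>t. s * norm (x t - a) + r * norm (x t - b)) \<longlongrightarrow> s * N a + r * N b) at_top"
          using ab by (intro tendsto_intros N) (auto simp: K_def)
        have "norm (x t - (s *\<^sub>R a + r *\<^sub>R b)) \<le> s * norm (x t - a) + r * norm (x t - b)" for t
        proof -
          have "x t - (s *\<^sub>R a + r *\<^sub>R b) = (s + r) *\<^sub>R x t - (s *\<^sub>R a + r *\<^sub>R b)" using sr by simp
          also have "\<dots> = s *\<^sub>R (x t - a) + r *\<^sub>R (x t - b)"
            by (simp add: algebra_simps)
          also have "norm \<dots> \<le> norm (s *\<^sub>R (x t - a)) + norm (r *\<^sub>R (x t - b))"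
            by (rule norm_triangle_ineq)
          finally show ?thesis using sr by simp
        qed
        then show "eventually (\<lambda>t. norm (x t - (s *\<^sub>R a + r *\<^sub>R b)) \<le> s * norm (x t - a) + r * norm (x t - b)) at_top"
          by simp
      qed simp
      moreover have "s * N a + r * N b \<le> m + 1 / real (Suc n)"
        using ab sr by (intro convex_bound_le) (auto simp: K_def)
      ultimately show "s *\<^sub>R a + r *\<^sub>R b \<in> K n" by (simp add: K_def)
    qed
    show "K n \<noteq> {}"
    proof
      assume "K n = {}"
      then have "m + 1 / real (Suc n) \<le> m"
        unfolding m_def using z0S by (intro cINF_greatest) (auto simp: K_def m_def not_le less_imp_le)
      then show False by simp
    qed
  next
    fix k n :: nat assume "k \<le> n"
    then have "1 / real (Suc n) \<le> 1 / real (Suc k)" by (simp add: frac_le)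
    then show "K n \<subseteq> K k" by (auto simp: K_def)
  next
    have "norm (a - z0) \<le> (m + 1) + N z0" if "a \<in> K 0" for a
    proof (rule tendsto_le[OF _ tendsto_add[OF N N[OF z0S]] tendsto_const, THEN order_trans])
      show "a \<in> S" using that by (simp add: K_def)
      show "eventually (\<lambda>t. norm (a - z0) \<le> norm (x t - a) + norm (x t - z0)) at_top"
        by (intro always_eventually allI) norm
      show "N a + N z0 \<le> (m + 1) + N z0" using that by (simp add: K_def)
    qed simp
    then show "bounded (K 0)"
      unfolding bounded_def by (metis dist_commute dist_norm)
  qed
  then obtain w where w: "\<And>n. w \<in> K n" by blast
  have wS: "w \<in> S" using w by (auto simp: K_def)
  have "(\<lambda>n. m + 1 / real (Suc n)) \<longlonglongrightarrow> m + 0"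
    by (intro tendsto_intros LIMSEQ_Suc lim_1_over_n[THEN LIMSEQ_Suc])
  then have "N w \<le> m + 0"
    by (rule LIMSEQ_le_const) (use w in \<open>auto simp: K_def\<close>)
  then have N_min: "N w \<le> N z" if "z \<in> S" for z using m_le[OF that] by simp
  have bd: "eventually (\<lambda>t. norm (x t) \<le> norm w + N w + 1) at_top"
    using order_tendstoD(2)[OF N[OF wS], of "N w + 1"]
    by (auto elim!: eventually_mono intro: order_trans[OF norm_triangle_sub[of _ w]])
  \<comment> \<open>If this fails, a weak cluster point \<open>y\<close> along the bad times is a
    minimiser of \<open>f\<close> different from \<open>w\<close>. Minimality of \<open>N w\<close>
    then keeps \<open>x t - w\<close> away from the direction \<open>y - w\<close>, which
    contradicts that \<open>y\<close> is a cluster point.\<close>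
  have ev: "eventually (\<lambda>t. inner (x t - w) v < \<epsilon>) at_top" if \<epsilon>: "\<epsilon> > 0" for v \<epsilon>
  proof (rule ccontr)
    assume "\<not> ?thesis"
    then have "frequently (\<lambda>t. \<epsilon> \<le> inner (x t - w) v) at_top"
      by (simp add: frequently_def not_le)
    from weak_cluster_point[OF bd this] obtain y where
      y: "\<And>C. \<lbrakk>closed C; convex C; eventually (\<lambda>t. \<epsilon> \<le> inner (x t - w) v \<longrightarrow> x t \<in> C) at_top\<rbrakk> \<Longrightarrow> y \<in> C"
      by blast
    have half: "closed {q. a \<le> inner q b}" "convex {q. a \<le> inner q b}" for a and b :: 'a
      using closed_halfspace_ge[of a b] convex_halfspace_ge[of a b]
      by (simp_all add: inner_commute)
    have "y \<in> {q. inner w v + \<epsilon> \<le> inner q v}"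
      by (rule y[OF half]) (simp add: inner_diff_left algebra_simps)
    then have yw: "y \<noteq> w" using \<epsilon> by auto
    have "f y \<le> f z0 + \<eta>" if "\<eta> > 0" for \<eta>
    proof -
      have "eventually (\<lambda>t. f (x t) < f z0 + \<eta>) at_top"
        using val that by (intro order_tendstoD) auto
      then have "y \<in> {q. f q \<le> f z0 + \<eta>}"
        by (intro y sub_closed sub_convex) (auto elim: eventually_mono)
      then show ?thesis by simp
    qed
    then have yS: "y \<in> S" unfolding S_def by (auto intro: field_le_epsilon)
    define d where "d = y - w"
    have d: "(norm d)\<^sup>2 > 0" using yw by (simp add: d_def)
    \<comment> \<open>Polarisation writes the inner product with \<open>d\<close> through distances
      to the minimisers \<open>w\<close> and \<open>y\<close>, and those converge.\<close>
    have "((\<lambda>t. ((norm (x t - w))\<^sup>2 + (norm d)\<^sup>2 - (norm (x t - y))\<^sup>2) / 2)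
        \<longlongrightarrow> ((N w)\<^sup>2 + (norm d)\<^sup>2 - (N y)\<^sup>2) / 2) at_top"
      by (intro tendsto_intros N wS yS) simp
    moreover have "((norm (x t - w))\<^sup>2 + (norm d)\<^sup>2 - (norm (x t - y))\<^sup>2) / 2 = inner (x t - w) d" for t
      by (simp add: d_def power2_norm_eq_inner inner_simps inner_commute)
    ultimately have "((\<lambda>t. inner (x t - w) d) \<longlongrightarrow> ((N w)\<^sup>2 + (norm d)\<^sup>2 - (N y)\<^sup>2) / 2) at_top"
      by simp
    \<comment> \<open>As \<open>N w \<le> N y\<close>, the limit is at most half of
      \<open>(norm d)\<^sup>2\<close>, whereas the value at \<open>y\<close> is all of it. Any
      factor strictly between 1/2 and 1 separates the two.\<close>
    moreover have "((N w)\<^sup>2 + (norm d)\<^sup>2 - (N y)\<^sup>2) / 2 < 3 / 4 * (norm d)\<^sup>2"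
    proof -
      have "(p + q - r) / 2 < 3 / 4 * q" if "p \<le> r" "0 < q" for p q r :: real
        using that by simp
      then show ?thesis using power_mono[OF N_min[OF yS] N_nonneg[OF wS]] d .
    qed
    ultimately have "eventually (\<lambda>t. inner (x t - w) d < 3 / 4 * (norm d)\<^sup>2) at_top"
      by (rule order_tendstoD)
    then have "eventually (\<lambda>t. \<epsilon> \<le> inner (x t - w) v \<longrightarrow>
        x t \<in> {q. - (inner w d + 3 / 4 * (norm d)\<^sup>2) \<le> inner q (- d)}) at_top"
      by eventually_elim (simp add: inner_diff_left)
    then have "y \<in> {q. - (inner w d + 3 / 4 * (norm d)\<^sup>2) \<le> inner q (- d)}"
      by (rule y[OF half])
    then have "inner (y - w) d \<le> 3 / 4 * (norm d)\<^sup>2"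
      by (simp add: inner_diff_left)
    then show False using d unfolding d_def power2_norm_eq_inner by simp
  qed
  have "weakly_tendsto x w at_top"
    unfolding weakly_tendsto_def
  proof (intro allI tendstoI)
    fix v and \<epsilon> :: real assume "\<epsilon> > 0"
    \<comment> \<open>Only upper bounds were shown; using \<open>v\<close> and \<open>- v\<close>
      makes the estimate two-sided.\<close>
    from ev[OF this, of v] ev[OF this, of "- v"]
    show "eventually (\<lambda>t. dist (inner (x t) v) (inner w v) < \<epsilon>) at_top"
      by eventually_elim (auto simp: dist_real_def inner_diff_left abs_if)
  qed
  then show ?thesis using wS S_iff unfolding S_def by blast
qed

subsection \<open>Antiderivatives and limits at infinity\<close>

lemma at_within_atLeast:
  fixes a t :: real
  assumes "a < t"
  shows "at t within {a..} = at t"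
  using assms by (intro at_within_interior) (simp add: interior_Ici[of "a - 1"])

lemma integral_atLeast_has_real_derivative:
  fixes \<phi> :: "real \<Rightarrow> real"
  assumes "continuous_on {a..} \<phi>" "a \<le> t"
  shows "((\<lambda>s. integral {a..s} \<phi>) has_real_derivative \<phi> t) (at t within {a..})"
proof -
  have "((\<lambda>s. integral {a..s} \<phi>) has_real_derivative \<phi> t) (at t within {a..t + 1})"
    using assms by (intro integral_has_real_derivative continuous_on_subset[OF assms(1)]) auto
  also have "at t within {a..t + 1} = at t within {a..}"
    by (rule at_within_nhd[of _ "{..<t + 1}"]) auto
  finally show ?thesis .
qed

text \<open>Turns integrability on a half-line into a bounded antiderivative, the form in which the
  hypotheses on \<open>e\<close> and \<open>e'\<close> are used afterwards.\<close>

lemma bounded_antiderivative: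
  fixes \<phi> :: "real \<Rightarrow> real"
  assumes cont: "continuous_on {a..} \<phi>" and nonneg: "\<And>t. a \<le> t \<Longrightarrow> 0 \<le> \<phi> t"
    and int: "\<phi> integrable_on {a..}"
  obtains A B where "\<And>t. a \<le> t \<Longrightarrow> (A has_real_derivative \<phi> t) (at t within {a..})"
    and "\<And>t. a \<le> t \<Longrightarrow> 0 \<le> A t \<and> A t \<le> B"
proof
  fix t assume t: "a \<le> t"
  show "((\<lambda>s. integral {a..s} \<phi>) has_real_derivative \<phi> t) (at t within {a..})"
    using cont t by (rule integral_atLeast_has_real_derivative)
  have i: "\<phi> integrable_on {a..t}"
    using cont by (intro integrable_continuous_real continuous_on_subset[OF cont]) auto
  have "0 \<le> integral {a..t} \<phi>" using i nonneg by (intro integral_nonneg) auto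
  moreover have "integral {a..t} \<phi> \<le> integral {a..} \<phi>"
    using i int nonneg by (intro integral_subset_le) auto
  ultimately show "0 \<le> integral {a..t} \<phi> \<and> integral {a..t} \<phi> \<le> integral {a..} \<phi>" ..
qed

lemma nondecreasing_bounded_tendsto:
  fixes F :: "real \<Rightarrow> real"
  assumes mono: "\<And>s t. T \<le> s \<Longrightarrow> s \<le> t \<Longrightarrow> F s \<le> F t" and bd: "\<And>t. T \<le> t \<Longrightarrow> F t \<le> B"
  shows "\<exists>L. (F \<longlongrightarrow> L) at_top"
proof -
  have bdd: "bdd_above (F ` {T..})" using bd by (intro bdd_aboveI2) auto
  have "(F \<longlongrightarrow> (SUP t\<in>{T..}. F t)) at_top"
  proof (rule increasing_tendsto)
    show "\<forall>\<^sub>F t in at_top. F t \<le> (SUP t\<in>{T..}. F t)"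
      using eventually_ge_at_top[of T] by eventually_elim (intro cSUP_upper bdd, auto)
  next
    fix y assume "y < (SUP t\<in>{T..}. F t)"
    then obtain s where s: "T \<le> s" "y < F s"
      using bdd by (subst (asm) less_cSUP_iff) auto
    show "\<forall>\<^sub>F t in at_top. y < F t"
      using eventually_ge_at_top[of s] by eventually_elim (use mono s in force)
  qed
  then show ?thesis ..
qed

text \<open>Both \<open>G\<close> and \<open>G + F\<close> are nondecreasing and bounded above,
  hence converge, and \<open>F\<close> is their difference. The bound on \<open>G + F\<close> comes
  from monotonicity of \<open>G - F\<close>.\<close>

lemma dominated_deriv_tendsto:
  fixes F G F' G' :: "real \<Rightarrow> real"
  assumes F: "\<And>t. T \<le> t \<Longrightarrow> (F has_real_derivative F' t) (at t)"
    and G: "\<And>t. T \<le> t \<Longrightarrow> (G has_real_derivative G' t) (at t)"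
    and dom: "\<And>t. T \<le> t \<Longrightarrow> \<bar>F' t\<bar> \<le> G' t" and bd: "\<And>t. T \<le> t \<Longrightarrow> G t \<le> B"
  shows "\<exists>L. (F \<longlongrightarrow> L) at_top"
proof -
  have G_mono: "G s \<le> G t" if "T \<le> s" "s \<le> t" for s t
    using that(2)
  proof (rule DERIV_nonneg_imp_nondecreasing)
    fix r assume "s \<le> r" "r \<le> t"
    then have r: "T \<le> r" using that by simp
    show "\<exists>y. (G has_real_derivative y) (at r) \<and> 0 \<le> y"
      using G[OF r] dom[OF r] by (intro exI[of _ "G' r"]) auto
  qed
  have plus: "G s + F s \<le> G t + F t" if "T \<le> s" "s \<le> t" for s t
    using that(2)
  proof (rule DERIV_nonneg_imp_nondecreasing[where f = "\<lambda>t. G t + F t"])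
    fix r assume "s \<le> r" "r \<le> t"
    then have r: "T \<le> r" using that by simp
    show "\<exists>y. ((\<lambda>t. G t + F t) has_real_derivative y) (at r) \<and> 0 \<le> y"
      using DERIV_add[OF G[OF r] F[OF r]] dom[OF r] by (intro exI[of _ "G' r + F' r"]) auto
  qed
  have minus: "G s - F s \<le> G t - F t" if "T \<le> s" "s \<le> t" for s t
    using that(2)
  proof (rule DERIV_nonneg_imp_nondecreasing[where f = "\<lambda>t. G t - F t"])
    fix r assume "s \<le> r" "r \<le> t"
    then have r: "T \<le> r" using that by simp
    show "\<exists>y. ((\<lambda>t. G t - F t) has_real_derivative y) (at r) \<and> 0 \<le> y"
      using DERIV_diff[OF G[OF r] F[OF r]] dom[OF r] by (intro exI[of _ "G' r - F' r"]) auto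
  qed
  obtain L1 where L1: "(G \<longlongrightarrow> L1) at_top"
    using nondecreasing_bounded_tendsto[of T G B] G_mono bd by blast
  have "G t + F t \<le> 2 * B - G T + F T" if "T \<le> t" for t
    using minus[OF _ that] bd[OF that] by simp
  then obtain L2 where L2: "((\<lambda>t. G t + F t) \<longlongrightarrow> L2) at_top"
    using nondecreasing_bounded_tendsto[of T "\<lambda>t. G t + F t"] plus by blast
  show ?thesis using tendsto_diff[OF L2 L1] by auto
qed

text \<open>L'Hopital's rule for \<open>t powr a * H t\<close> over \<open>t powr a\<close>: the
  quotient of the derivatives is \<open>(t * H' t + a * H t) / a\<close>.\<close>

lemma euler_operator_tendsto:
  fixes H H' :: "real \<Rightarrow> real"
  assumes a: "0 < a" and H: "\<And>t. T \<le> t \<Longrightarrow> (H has_real_derivative H' t) (at t)"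
    and lim: "((\<lambda>t. t * H' t + a * H t) \<longlongrightarrow> l) at_top"
  shows "(H \<longlongrightarrow> l / a) at_top"
proof -
  have "((\<lambda>t. (t powr a * H t) / t powr a) \<longlongrightarrow> l / a) at_top"
  proof (rule lhospital_at_top_at_top)
    show "filterlim (\<lambda>t. t powr a) at_top at_top"
    proof (rule filterlim_mono_eventually)
      show "filterlim (\<lambda>t. exp (a * ln t)) at_top at_top"
        by (intro filterlim_compose[OF exp_at_top]
          filterlim_tendsto_pos_mult_at_top[OF tendsto_const a ln_at_top])
      show "\<forall>\<^sub>F t in at_top. exp (a * ln t) = t powr a"
        using eventually_gt_at_top[of 0] by eventually_elim (simp add: powr_def)
    qed simp_all
    show "\<forall>\<^sub>F t in at_top. a * t powr (a - 1) \<noteq> 0"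
      using eventually_gt_at_top[of 0] by eventually_elim (use a in auto)
    show "\<forall>\<^sub>F t in at_top. ((\<lambda>t. t powr a * H t) has_real_derivative
        (a * t powr (a - 1)) * H t + H' t * t powr a) (at t)"
      using eventually_gt_at_top[of "max 0 T"]
      by eventually_elim (intro DERIV_mult has_real_derivative_powr H, auto)
    show "\<forall>\<^sub>F t in at_top. ((\<lambda>t. t powr a) has_real_derivative a * t powr (a - 1)) (at t)"
      using eventually_gt_at_top[of 0] by eventually_elim (intro has_real_derivative_powr)
    have "((\<lambda>t. (t * H' t + a * H t) / a) \<longlongrightarrow> l / a) at_top"
      using a by (intro tendsto_divide lim tendsto_const) auto
    then show "((\<lambda>t. (a * t powr (a - 1) * H t + H' t * t powr a) / (a * t powr (a - 1))) \<longlongrightarrow> l / a) at_top"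
    proof (rule Lim_transform_eventually)
      show "\<forall>\<^sub>F t in at_top. (t * H' t + a * H t) / a =
          (a * t powr (a - 1) * H t + H' t * t powr a) / (a * t powr (a - 1))"
        using eventually_gt_at_top[of 0]
      proof eventually_elim
        case (elim t)
        have "t powr a = t * t powr (a - 1)"
          using elim by (simp add: powr_diff)
        then show ?case using a elim by (simp add: field_simps)
      qed
    qed
  qed
  then show ?thesis
  proof (rule Lim_transform_eventually)
    show "\<forall>\<^sub>F t in at_top. t powr a * H t / t powr a = H t"
      using eventually_gt_at_top[of 0] by eventually_elim auto
  qed
qed

section \<open>Product rule for inner products and the gradient inequality\<close>

lemma has_real_derivative_inner:
  fixes p q :: "real \<Rightarrow> 'a::real_inner"
  assumes "(p has_vector_derivative p') (at t within S)" "(q has_vector_derivative q') (at t within S)"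
  shows "((\<lambda>s. inner (p s) (q s)) has_real_derivative inner (p t) q' + inner p' (q t)) (at t within S)"
  unfolding has_real_derivative_iff_has_vector_derivative
  using bounded_bilinear.has_vector_derivative[OF bounded_bilinear_inner assms] .

text \<open>On the line through \<open>y\<close> and \<open>z\<close> the function is convex in one
  real variable; its tangent at \<open>y\<close> lies below its value at \<open>z\<close>.\<close>

lemma convex_on_gradient_ineq:
  fixes f :: "'a::real_inner \<Rightarrow> real"
  assumes conv: "convex_on UNIV f" and der: "(f has_derivative (\<lambda>h. inner G h)) (at y)"
  shows "f y - f z \<le> inner G (y - z)"
proof -
  define \<phi> where "\<phi> s = f (y + s *\<^sub>R (z - y))" for s :: real
  have "convex_on UNIV \<phi>"
  proof (rule convex_onI)
    fix s a b :: real assume s: "0 < s" "s < 1"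
    have "y + ((1 - s) *\<^sub>R a + s *\<^sub>R b) *\<^sub>R (z - y)
        = (1 - s) *\<^sub>R (y + a *\<^sub>R (z - y)) + s *\<^sub>R (y + b *\<^sub>R (z - y))"
      by (simp add: algebra_simps)
    then show "\<phi> ((1 - s) *\<^sub>R a + s *\<^sub>R b) \<le> (1 - s) * \<phi> a + s * \<phi> b"
      unfolding \<phi>_def using convex_onD[OF conv, of s] s by simp
  qed simp
  moreover have "(\<phi> has_real_derivative inner G (z - y)) (at 0)"
  proof -
    have "((\<lambda>s. y + s *\<^sub>R (z - y)) has_derivative (\<lambda>s. s *\<^sub>R (z - y))) (at 0)"
      by (auto intro!: derivative_eq_intros)
    moreover have "(f has_derivative (\<lambda>h. inner G h)) (at (y + 0 *\<^sub>R (z - y)))"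
      using der by simp
    ultimately have "(\<phi> has_derivative (\<lambda>s. inner G (s *\<^sub>R (z - y)))) (at 0)"
      unfolding \<phi>_def by (rule has_derivative_compose)
    then show ?thesis
      by (simp add: has_field_derivative_def mult.commute[of _ "inner G (z - y)"] mult_commute_abs)
  qed
  ultimately have "\<phi> 1 - \<phi> 0 \<ge> inner G (z - y) * (1 - 0)"
    by (intro convex_on_imp_above_tangent[of UNIV]) auto
  then show ?thesis by (simp add: \<phi>_def inner_diff_right)
qed

subsection \<open>Lyapunov analysis\<close>

text \<open>The analysis for one fixed minimiser \<open>z\<close>. The function \<open>g\<close> and
  its derivative are parameters, so second-order information on \<open>f\<close> enters only through
  \<open>g'\<close>. The perturbation enters through the bounded antiderivative \<open>A\<close> of
  \<open>t * norm (e t)\<close> and the pointwise bound \<open>M\<close>. Times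
  \<open>t > t0\<close> allow two-sided derivatives.\<close>

locale perturbed_trajectory =
  fixes f :: "'a::real_inner \<Rightarrow> real" and gradf :: "'a \<Rightarrow> 'a"
    and e g g' x x' x'' :: "real \<Rightarrow> 'a" and A :: "real \<Rightarrow> real"
    and t0 \<alpha> \<beta> A_max M :: real and z :: 'a
  assumes t0_pos: "t0 > 0" and alpha: "\<alpha> > 3" and beta: "\<beta> > 0"
    and f_grad: "\<And>y. (f has_derivative (\<lambda>h. inner (gradf y) h)) (at y)"
    and f_convex: "convex_on UNIV f"
    and z_min: "\<And>y. f z \<le> f y"
    and g_def: "\<And>t. g t = gradf (x t) + e t"
    and x_deriv: "\<And>t. t > t0 \<Longrightarrow> (x has_vector_derivative x' t) (at t)"
    and x'_deriv: "\<And>t. t > t0 \<Longrightarrow> (x' has_vector_derivative x'' t) (at t)"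
    and g_deriv: "\<And>t. t > t0 \<Longrightarrow> (g has_vector_derivative g' t) (at t)"
    and ode: "\<And>t. t > t0 \<Longrightarrow> x'' t + (\<alpha> / t) *\<^sub>R x' t + \<beta> *\<^sub>R g' t + g t = 0"
    and A_deriv: "\<And>t. t > t0 \<Longrightarrow> (A has_real_derivative t * norm (e t)) (at t)"
    and A_bounds: "\<And>t. t > t0 \<Longrightarrow> 0 \<le> A t \<and> A t \<le> A_max"
    and e_bound: "\<And>t. t > t0 \<Longrightarrow> t * norm (e t) \<le> M"
begin

text \<open>Any \<open>lam\<close> strictly between \<open>2\<close> and \<open>\<alpha> - 1\<close> would do: \<open>lam > 2\<close> makes the coefficient of the gap
  \<open>f (x t) - f z\<close> in \<open>E'\<close> negative for large \<open>t\<close>, and \<open>lam < \<alpha> - 1\<close> gives the dissipation of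
  \<open>t * (norm (x' t))\<^sup>2\<close>. The weight \<open>\<delta>\<close> is the one for which \<open>inner (gradf (x t)) (x' t)\<close> cancels in \<open>E'\<close>.\<close>

definition "c = (\<alpha> - 3) / 2"

definition "lam = 2 + c"

definition "u t = lam *\<^sub>R (x t - z) + t *\<^sub>R (x' t + \<beta> *\<^sub>R g t)"

definition "\<delta> t = t\<^sup>2 + (c - 1) * \<beta> * t"

definition "E t = \<delta> t * (f (x t) - f z) + inner (u t) (u t) / 2
  + lam * c / 2 * inner (x t - z) (x t - z)"

definition "P t = inner (gradf (x t)) (x t - z)"

definition "E' t = (2 * t + (c - 1) * \<beta>) * (f (x t) - f z) - \<delta> t * inner (e t) (x' t)
  - lam * (t - \<beta>) * (P t + inner (e t) (x t - z)) - c * t * (norm (x' t))\<^sup>2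
  - \<beta> * t * (t - \<beta>) * (norm (g t))\<^sup>2"

text \<open>The part of the dissipation that survives in \<open>E'_le\<close>: half of the leading
  \<open>P\<close> term, and half of the \<open>g\<close> term left after
  \<open>t - \<beta> \<ge> t / 2\<close>. The other halves absorb lower-order terms and the
  perturbation.\<close>

definition "D t = c / 2 * t * P t + c * t * (norm (x' t))\<^sup>2 + \<beta> / 4 * t\<^sup>2 * (norm (g t))\<^sup>2"

text \<open>The entry \<open>2 * \<beta>\<close> gives \<open>t - \<beta> \<ge> t / 2\<close> and
  makes \<open>\<delta> t\<close> comparable to \<open>t\<^sup>2\<close>; the last entry lets half
  of \<open>c * t\<close> dominate \<open>(2 * c + 1) * \<beta>\<close> in the coefficient of
  \<open>P\<close>.\<close>

definition "T = max (max (t0 + 1) 1) (max (2 * \<beta>) (2 * (2 * c + 1) * \<beta> / c))"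

text \<open>The three summands are the costs of pairing \<open>e\<close> with \<open>u\<close>, with
  \<open>x - z\<close> and with \<open>g\<close> in \<open>E'_le\<close>.\<close>

definition "K = (1 + c) + (2 + c) * lam * (1 + 2 / (lam * c)) + \<beta> * (1 + c)\<^sup>2 * M"

definition "W t = (1 + E t) * exp (- K * A t)"

definition "W' t = (E' t - K * (t * norm (e t)) * (1 + E t)) * exp (- K * A t)"

text \<open>With this \<open>c\<close>, \<open>lam\<close> is the midpoint of 2 and
  \<open>\<alpha> - 1\<close>, so that \<open>lam - 2\<close> and \<open>\<alpha> - 1 - lam\<close>
  both equal \<open>c\<close>.\<close>

lemma c_pos: "0 < c" and lam_minus_alpha: "lam + 1 - \<alpha> = - c" and lam_pos: "0 < lam"
  using alpha by (simp_all add: c_def lam_def field_simps)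

lemma T_ge: "T \<ge> 1" "T > t0" "T \<ge> 2 * \<beta>" "c * T \<ge> 2 * (2 * c + 1) * \<beta>"
proof -
  have "2 * (2 * c + 1) * \<beta> / c \<le> T" by (simp add: T_def)
  then show "c * T \<ge> 2 * (2 * c + 1) * \<beta>" using c_pos by (simp add: field_simps)
qed (auto simp: T_def)

lemma P_ge: "f (x t) - f z \<le> P t"
  unfolding P_def by (rule convex_on_gradient_ineq[OF f_convex f_grad])

lemma gap_nonneg: "0 \<le> f (x t) - f z"
  using z_min by simp

lemma P_nonneg: "0 \<le> P t"
  by (rule order_trans[OF gap_nonneg P_ge])

lemma M_nonneg: "0 \<le> M"
  using t0_pos by (intro order_trans[OF _ e_bound[of "t0 + 1"]]) auto

lemma K_nonneg: "0 \<le> K"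
  unfolding K_def using c_pos lam_pos M_nonneg beta by simp

section \<open>Derivative of the energy along the trajectory\<close>

lemma E_deriv:
  assumes t: "t > t0"
  shows "(E has_real_derivative E' t) (at t)"
proof -
  define xx where "xx = x'' t"
  have tp: "t > 0" using t t0_pos by simp
  have xx: "xx = - (\<alpha> / t) *\<^sub>R x' t - \<beta> *\<^sub>R g' t - g t"
    using ode[OF t] unfolding xx_def by (simp add: algebra_simps eq_neg_iff_add_eq_0)
  have y: "((\<lambda>s. x s - z) has_vector_derivative x' t) (at t)"
    using x_deriv[OF t] by (auto intro!: derivative_eq_intros)
  have "(u has_vector_derivative
      lam *\<^sub>R x' t + (t *\<^sub>R (xx + \<beta> *\<^sub>R g' t) + 1 *\<^sub>R (x' t + \<beta> *\<^sub>R g t))) (at t)"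
    unfolding u_def[abs_def] xx_def using x_deriv[OF t] x'_deriv[OF t] g_deriv[OF t]
    by (auto intro!: derivative_eq_intros)
  \<comment> \<open>Multiplying the equation by \<open>t\<close> eliminates the second derivative
    and \<open>g'\<close> together; this is why \<open>u\<close> contains
    \<open>\<beta> *\<^sub>R g t\<close>.\<close>
  also have "lam *\<^sub>R x' t + (t *\<^sub>R (xx + \<beta> *\<^sub>R g' t) + 1 *\<^sub>R (x' t + \<beta> *\<^sub>R g t))
      = (\<beta> - t) *\<^sub>R g t - c *\<^sub>R x' t"
  proof -
    have "t *\<^sub>R (xx + \<beta> *\<^sub>R g' t) = - \<alpha> *\<^sub>R x' t - t *\<^sub>R g t"
      unfolding xx using tp by (simp add: algebra_simps)
    then have "lam *\<^sub>R x' t + (t *\<^sub>R (xx + \<beta> *\<^sub>R g' t) + 1 *\<^sub>R (x' t + \<beta> *\<^sub>R g t))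
        = lam *\<^sub>R x' t + (- \<alpha> *\<^sub>R x' t - t *\<^sub>R g t + 1 *\<^sub>R (x' t + \<beta> *\<^sub>R g t))"
      by simp
    also have "\<dots> = (\<beta> - t) *\<^sub>R g t + (lam + 1 - \<alpha>) *\<^sub>R x' t"
      by (simp add: algebra_simps)
    finally show ?thesis by (simp add: lam_minus_alpha)
  qed
  finally have u: "(u has_vector_derivative (\<beta> - t) *\<^sub>R g t - c *\<^sub>R x' t) (at t)" .
  have fx: "((\<lambda>s. f (x s)) has_real_derivative inner (gradf (x t)) (x' t)) (at t)"
  proof -
    have "((\<lambda>s. f (x s)) has_derivative (\<lambda>s. inner (gradf (x t)) (s *\<^sub>R x' t))) (at t)"
      using x_deriv[OF t] f_grad unfolding has_vector_derivative_def by (rule has_derivative_compose)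
    then show ?thesis
      by (simp add: has_field_derivative_def mult_commute_abs)
  qed
  have d: "(\<delta> has_real_derivative 2 * t + (c - 1) * \<beta>) (at t)"
    unfolding \<delta>_def[abs_def] by (auto intro!: derivative_eq_intros)
  have "(E has_real_derivative
      ((2 * t + (c - 1) * \<beta>) * (f (x t) - f z) + inner (gradf (x t)) (x' t) * \<delta> t)
      + 2 * inner (u t) ((\<beta> - t) *\<^sub>R g t - c *\<^sub>R x' t) / 2
      + lam * c / 2 * (2 * inner (x t - z) (x' t))) (at t)"
    unfolding E_def[abs_def]
    by (intro DERIV_add DERIV_cmult DERIV_cdivide DERIV_mult d)
      (use fx has_real_derivative_inner[OF u u] has_real_derivative_inner[OF y y] in
        \<open>auto intro!: derivative_eq_intros simp: inner_commute\<close>)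
  moreover have "((2 * t + (c - 1) * \<beta>) * (f (x t) - f z) + inner (gradf (x t)) (x' t) * \<delta> t)
      + 2 * inner (u t) ((\<beta> - t) *\<^sub>R g t - c *\<^sub>R x' t) / 2
      + lam * c / 2 * (2 * inner (x t - z) (x' t)) = E' t"
  proof -
    define y v h where yvh: "y = x t - z" "v = x' t" "h = g t"
    have gr: "gradf (x t) = h - e t" by (simp add: g_def yvh)
    have u': "u t = lam *\<^sub>R y + t *\<^sub>R v + (t * \<beta>) *\<^sub>R h"
      by (simp add: u_def yvh algebra_simps)
    \<comment> \<open>Here \<open>inner h v\<close> has total coefficient
      \<open>- \<delta> t\<close>, cancelled by the derivative of the gap term up to
      \<open>e\<close>; the term in \<open>inner y v\<close> cancels against the last summand of
      \<open>E\<close>.\<close>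
    have 1: "inner (u t) ((\<beta> - t) *\<^sub>R h - c *\<^sub>R v) =
      (\<beta> - t) * (lam * inner h y + t * inner h v + t * \<beta> * inner h h)
      - c * (lam * inner y v + t * inner v v + t * \<beta> * inner h v)"
      unfolding u' by (simp add: inner_simps inner_commute algebra_simps)
    have 2: "P t + inner (e t) y = inner h y"
      unfolding P_def gr by (simp add: yvh inner_simps)
    show ?thesis
      unfolding E'_def power2_norm_eq_inner yvh[symmetric] 1 2 gr \<delta>_def
      by (simp add: inner_diff_left field_simps power2_eq_square)
  qed
  ultimately show ?thesis by simp
qed

section \<open>Coercivity of the energy and the dissipation inequality\<close>

lemma \<delta>_bounds:
  assumes "t \<ge> T"
  shows "t\<^sup>2 / 2 \<le> \<delta> t" "\<delta> t \<le> (1 + c) * t\<^sup>2"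
proof -
  have t: "t \<ge> 1" "2 * \<beta> \<le> t" using assms T_ge by auto
  have 1: "2 * \<beta> * t \<le> t\<^sup>2" using t by (simp add: power2_eq_square mult_right_mono)
  have "0 \<le> \<beta> * t" using t beta by simp
  then have 2: "0 \<le> c * (\<beta> * t)" using c_pos by simp
  have 3: "c * (\<beta> * t) \<le> c * t\<^sup>2" using 1 \<open>0 \<le> \<beta> * t\<close> c_pos by simp
  show "t\<^sup>2 / 2 \<le> \<delta> t" "\<delta> t \<le> (1 + c) * t\<^sup>2"
    using 1 2 3 \<open>0 \<le> \<beta> * t\<close> by (simp_all add: \<delta>_def algebra_simps)
qed

lemma E_ge:
  assumes "t \<ge> T"
  shows "(norm (u t))\<^sup>2 / 2 + lam * c / 2 * (norm (x t - z))\<^sup>2 \<le> E t"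
    and "t\<^sup>2 / 2 * (f (x t) - f z) \<le> E t"
proof -
  have "0 \<le> t\<^sup>2 / 2 * (f (x t) - f z)" using gap_nonneg[of t] by simp
  moreover have "t\<^sup>2 / 2 * (f (x t) - f z) \<le> \<delta> t * (f (x t) - f z)"
    using \<delta>_bounds[OF assms] gap_nonneg by (intro mult_right_mono) auto
  moreover have "0 \<le> (norm (u t))\<^sup>2 / 2" "0 \<le> lam * c / 2 * (norm (x t - z))\<^sup>2"
    using lam_pos c_pos by simp_all
  ultimately show "(norm (u t))\<^sup>2 / 2 + lam * c / 2 * (norm (x t - z))\<^sup>2 \<le> E t"
    and "t\<^sup>2 / 2 * (f (x t) - f z) \<le> E t"
    unfolding E_def power2_norm_eq_inner by linarith+
qed

lemma E_nonneg: "t \<ge> T \<Longrightarrow> 0 \<le> E t"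
  using gap_nonneg[of t] by (intro order_trans[OF _ E_ge(2)]) auto

text \<open>By \<open>2 * s \<le> 1 + s\<^sup>2\<close> the norms are bounded affinely in
  \<open>E\<close> instead of by its square root, which makes the Gronwall argument linear in
  \<open>1 + E\<close>.\<close>

lemma norm_bounds_E:
  assumes "t \<ge> T"
  shows "norm (u t) \<le> 1 + E t" "norm (x t - z) \<le> (1 + 2 / (lam * c)) * (1 + E t)"
proof -
  have lc: "0 < lam * c" using lam_pos c_pos by simp
  have 1: "2 * norm (u t) \<le> 1 + (norm (u t))\<^sup>2" "2 * norm (x t - z) \<le> 1 + (norm (x t - z))\<^sup>2"
    using zero_le_power2[of "norm (u t) - 1"] zero_le_power2[of "norm (x t - z) - 1"]
    by (simp_all add: power2_diff)
  have 0: "0 \<le> lam * c / 2 * (norm (x t - z))\<^sup>2" using lc by simp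
  show "norm (u t) \<le> 1 + E t" using 0 1 E_ge(1)[OF assms] by simp
  have "lam * c / 2 * (norm (x t - z))\<^sup>2 \<le> E t"
    by (rule order_trans[OF _ E_ge(1)[OF assms]]) simp
  then have "(norm (x t - z))\<^sup>2 \<le> 2 / (lam * c) * E t"
    using lc by (simp add: field_simps)
  then have "norm (x t - z) \<le> 1 + 2 / (lam * c) * E t"
    using 1 zero_le_power2[of "norm (x t - z)"] by linarith
  also have "\<dots> \<le> (1 + 2 / (lam * c)) * (1 + E t)"
    using E_nonneg[OF assms] lc by (simp add: algebra_simps)
  finally show "norm (x t - z) \<le> (1 + 2 / (lam * c)) * (1 + E t)" .
qed

lemma D_nonneg: "t \<ge> T \<Longrightarrow> 0 \<le> D t"
  unfolding D_def using T_ge(1) c_pos beta P_nonneg by (intro add_nonneg_nonneg mult_nonneg_nonneg) auto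

lemma E'_le:
  assumes tT: "t \<ge> T"
  shows "E' t \<le> - D t + K * (t * norm (e t)) * (1 + E t)"
proof -
  have t: "t \<ge> 1" "t > t0" "2 * \<beta> \<le> t" "2 * (2 * c + 1) * \<beta> \<le> c * t"
    using tT T_ge c_pos mult_left_mono[OF tT, of c] by linarith+
  define n where "n = t * norm (e t)"
  define r where "r = norm (x t - z)"
  define G where "G = t * norm (g t)"
  have nn: "0 \<le> n" "0 \<le> r" "0 \<le> G" using t by (simp_all add: n_def r_def G_def)
  \<comment> \<open>The gap is replaced by the larger \<open>P t\<close>. Since
    \<open>lam = 2 + c\<close>, the coefficient becomes
    \<open>- c * t + (2 * c + 1) * \<beta>\<close>, and half of \<open>c * t\<close> pays for the
    \<beta> term.\<close>
  have 1: "(2 * t + (c - 1) * \<beta>) * (f (x t) - f z) - lam * (t - \<beta>) * P t \<le> - (c / 2 * t * P t)"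
  proof -
    have "0 \<le> c * \<beta>" using c_pos beta by simp
    then have "0 \<le> 2 * t + (c - 1) * \<beta>" using t beta by (simp add: algebra_simps)
    then have "(2 * t + (c - 1) * \<beta>) * (f (x t) - f z) \<le> (2 * t + (c - 1) * \<beta>) * P t"
      using P_ge by (rule mult_left_mono[rotated])
    moreover have "(2 * t + (c - 1) * \<beta> - lam * (t - \<beta>) + c / 2 * t) * P t \<le> 0"
      using t P_nonneg by (intro mult_nonpos_nonneg) (simp_all add: lam_def algebra_simps)
    ultimately show ?thesis by (simp add: algebra_simps)
  qed
  have 2: "- (\<beta> * t * (t - \<beta>) * (norm (g t))\<^sup>2) \<le> - (\<beta> / 2 * G\<^sup>2)"
  proof -
    have "\<beta> * t * (t / 2) * (norm (g t))\<^sup>2 \<le> \<beta> * t * (t - \<beta>) * (norm (g t))\<^sup>2"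
      using t beta by (intro mult_right_mono mult_left_mono) auto
    then show ?thesis by (simp add: G_def power2_eq_square algebra_simps)
  qed
  have 3: "- (lam * (t - \<beta>) * inner (e t) (x t - z)) \<le> lam * n * r"
  proof -
    have "- inner (e t) (x t - z) \<le> norm (e t) * r"
      using Cauchy_Schwarz_ineq2[of "e t" "x t - z"] by (simp add: r_def)
    then have "(lam * (t - \<beta>)) * (- inner (e t) (x t - z)) \<le> (lam * (t - \<beta>)) * (norm (e t) * r)"
      using lam_pos t beta by (intro mult_left_mono) auto
    also have "\<dots> \<le> (lam * t) * (norm (e t) * r)"
      using lam_pos beta nn by (intro mult_right_mono mult_left_mono) auto
    finally show ?thesis by (simp add: n_def algebra_simps)
  qed
  \<comment> \<open>The velocity is recovered from \<open>u t\<close> by subtracting the position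
    and gradient parts; hence the extra term in \<open>G\<close>.\<close>
  have 4: "- (\<delta> t * inner (e t) (x' t)) \<le> (1 + c) * n * (norm (u t) + lam * r + \<beta> * G)"
  proof -
    have "t *\<^sub>R x' t = u t - lam *\<^sub>R (x t - z) - (t * \<beta>) *\<^sub>R g t"
      by (simp add: u_def algebra_simps)
    then have "norm (t *\<^sub>R x' t) \<le> norm (u t) + norm (lam *\<^sub>R (x t - z)) + norm ((t * \<beta>) *\<^sub>R g t)"
      by (metis norm_triangle_ineq4 norm_triangle_le_diff add_right_mono order_trans)
    then have v: "t * norm (x' t) \<le> norm (u t) + lam * r + \<beta> * G"
      using t beta lam_pos by (simp add: r_def G_def mult_ac)
    have \<delta>0: "0 \<le> \<delta> t" by (rule order_trans[OF _ \<delta>_bounds(1)[OF tT]]) simp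
    have "- inner (e t) (x' t) \<le> norm (e t) * norm (x' t)"
      using Cauchy_Schwarz_ineq2[of "e t" "x' t"] by simp
    then have "\<delta> t * - inner (e t) (x' t) \<le> \<delta> t * (norm (e t) * norm (x' t))"
      using \<delta>0 by (rule mult_left_mono)
    also have "\<dots> \<le> (1 + c) * t\<^sup>2 * (norm (e t) * norm (x' t))"
      using \<delta>_bounds(2)[OF tT] by (intro mult_right_mono) auto
    also have "\<dots> = (1 + c) * n * (t * norm (x' t))"
      by (simp add: n_def power2_eq_square)
    also have "\<dots> \<le> (1 + c) * n * (norm (u t) + lam * r + \<beta> * G)"
      using v c_pos nn by (intro mult_left_mono) auto
    finally show ?thesis by simp
  qed
  \<comment> \<open>Young's inequality spends half of the \<open>G\<^sup>2\<close> term from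
    \<open>2\<close>. It leaves \<open>n * n\<close>, which the bound \<open>n \<le> M\<close> makes
    linear in \<open>n\<close>, hence integrable in time.\<close>
  have 5: "(1 + c) * n * (\<beta> * G) \<le> \<beta> / 4 * G\<^sup>2 + \<beta> * (1 + c)\<^sup>2 * M * n"
  proof -
    have "\<beta> * ((1 + c) * n * G) \<le> \<beta> * (G\<^sup>2 / 4 + (1 + c)\<^sup>2 * (n * n))"
      using zero_le_power2[of "G / 2 - (1 + c) * n"] beta
      by (intro mult_left_mono) (simp_all add: power2_eq_square algebra_simps)
    moreover have "\<beta> * (1 + c)\<^sup>2 * (n * n) \<le> \<beta> * (1 + c)\<^sup>2 * (M * n)"
      using e_bound[OF t(2)] nn beta unfolding n_def[symmetric] by (intro mult_left_mono mult_right_mono) auto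
    ultimately show ?thesis by (simp add: algebra_simps)
  qed
  have 6: "(1 + c) * n * norm (u t) \<le> (1 + c) * n * (1 + E t)"
    using norm_bounds_E(1)[OF tT] c_pos nn by (intro mult_left_mono) auto
  have 7: "(2 + c) * lam * n * r \<le> (2 + c) * lam * n * ((1 + 2 / (lam * c)) * (1 + E t))"
    using norm_bounds_E(2)[OF tT] c_pos nn lam_pos unfolding r_def by (intro mult_left_mono) auto
  have 8: "\<beta> * (1 + c)\<^sup>2 * M * n * 1 \<le> \<beta> * (1 + c)\<^sup>2 * M * n * (1 + E t)"
    using E_nonneg[OF tT] beta M_nonneg nn by (intro mult_left_mono) auto
  have 9: "K * n * (1 + E t) = (1 + c) * n * (1 + E t)
      + (2 + c) * lam * n * ((1 + 2 / (lam * c)) * (1 + E t)) + \<beta> * (1 + c)\<^sup>2 * M * n * (1 + E t)"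
    unfolding K_def by (simp only: distrib_right distrib_left mult_ac)
  have 10: "(1 + c) * n * (norm (u t) + lam * r + \<beta> * G) + lam * n * r
      = (1 + c) * n * norm (u t) + (2 + c) * lam * n * r + (1 + c) * n * (\<beta> * G)"
    by (simp add: algebra_simps)
  have 11: "D t = c / 2 * t * P t + c * t * (norm (x' t))\<^sup>2 + \<beta> / 4 * G\<^sup>2"
    by (simp add: D_def G_def power_mult_distrib)
  have 12: "E' t = ((2 * t + (c - 1) * \<beta>) * (f (x t) - f z) - lam * (t - \<beta>) * P t)
      + (- (\<delta> t * inner (e t) (x' t))) + (- (lam * (t - \<beta>) * inner (e t) (x t - z)))
      - c * t * (norm (x' t))\<^sup>2 + (- (\<beta> * t * (t - \<beta>) * (norm (g t))\<^sup>2))"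
    by (simp add: E'_def algebra_simps)
  show ?thesis
    unfolding n_def[symmetric] 9 11 12 using 1 2 3 4 5 6 7 8 10 by linarith
qed

text \<open>Integrating factor (Gronwall): \<open>W\<close> is nonincreasing, and \<open>D\<close> is dominated by a multiple of \<open>- W'\<close>.
  All later integrability claims are expressed as domination by the derivative of a bounded function.\<close>

lemma W_deriv:
  assumes "t > t0"
  shows "(W has_real_derivative W' t) (at t)"
proof -
  have "((\<lambda>t. exp (- K * A t)) has_real_derivative
      exp (- K * A t) * (- K * (t * norm (e t)))) (at t)"
    by (intro DERIV_fun_exp DERIV_cmult A_deriv assms)
  from DERIV_mult[OF DERIV_add[OF DERIV_const[of 1] E_deriv[OF assms]] this]
  show ?thesis unfolding W_def[abs_def] by (simp add: W'_def algebra_simps)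
qed

text \<open>The integrating factor is bounded below because \<open>A\<close> is bounded, so
  returning from \<open>W\<close> to \<open>E\<close> costs only a constant factor.\<close>

lemma exp_A_bounds: "t > t0 \<Longrightarrow> 1 \<le> exp (K * A_max) * exp (- K * A t)"
  using mult_left_mono[of "A t" A_max K] A_bounds[of t] K_nonneg
  unfolding exp_add[symmetric] one_le_exp_iff by simp

lemma W'_le:
  assumes "t \<ge> T"
  shows "D t \<le> - exp (K * A_max) * W' t"
proof -
  have "t > t0" using assms T_ge by simp
  have "D t * 1 \<le> D t * (exp (K * A_max) * exp (- K * A t))"
    using D_nonneg[OF assms] exp_A_bounds[OF \<open>t > t0\<close>] by (rule mult_left_mono[rotated])
  also have "\<dots> \<le> - (E' t - K * (t * norm (e t)) * (1 + E t)) * (exp (K * A_max) * exp (- K * A t))"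
    using E'_le[OF assms] by (intro mult_right_mono) auto
  finally show ?thesis by (simp add: W'_def algebra_simps)
qed

definition "E_max = exp (K * A_max) * W T"

lemma E_le:
  assumes "t \<ge> T"
  shows "1 + E t \<le> E_max"
proof -
  have t: "t > t0" using assms T_ge by simp
  have "W t \<le> W T"
  proof (rule DERIV_nonpos_imp_nonincreasing[OF assms])
    fix s assume s: "T \<le> s" "s \<le> t"
    have "0 \<le> - exp (K * A_max) * W' s"
      using D_nonneg[OF s(1)] W'_le[OF s(1)] by simp
    then have "W' s \<le> 0" by (simp add: mult_le_0_iff zero_le_mult_iff)
    then show "\<exists>y. (W has_real_derivative y) (at s) \<and> y \<le> 0"
      using W_deriv[of s] s T_ge by force
  qed
  have "(1 + E t) * 1 \<le> (1 + E t) * (exp (K * A_max) * exp (- K * A t))"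
    using exp_A_bounds[OF t] E_nonneg[OF assms] by (intro mult_left_mono) auto
  also have "\<dots> = exp (K * A_max) * W t" by (simp add: W_def)
  also have "\<dots> \<le> E_max" unfolding E_max_def using \<open>W t \<le> W T\<close> by simp
  finally show ?thesis by simp
qed

section \<open>Convergence of the function values\<close>

text \<open>The bounded energy dominates \<open>t\<^sup>2 / 2\<close> times the gap, so the gap is
  of order \<open>1 / t\<^sup>2\<close>.\<close>

lemma values_tendsto: "((\<lambda>t. f (x t)) \<longlongrightarrow> f z) at_top"
proof -
  have "((\<lambda>t. f (x t) - f z) \<longlongrightarrow> 0) at_top"
  proof (rule tendsto_sandwich)
    show "\<forall>\<^sub>F t in at_top. 0 \<le> f (x t) - f z" using gap_nonneg by simp
    show "\<forall>\<^sub>F t in at_top. f (x t) - f z \<le> 2 * E_max * inverse (t\<^sup>2)"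
      using eventually_ge_at_top[of T]
    proof eventually_elim
      case (elim t)
      then have "t > 0" using T_ge by simp
      moreover have "t\<^sup>2 / 2 * (f (x t) - f z) \<le> E_max" using E_ge(2)[OF elim] E_le[OF elim] by simp
      ultimately show ?case by (simp add: field_simps)
    qed
    have "((\<lambda>t::real. 2 * E_max * inverse (t\<^sup>2)) \<longlongrightarrow> 2 * E_max * 0) at_top"
      by (intro tendsto_intros tendsto_inverse_0_at_top filterlim_pow_at_top filterlim_ident) auto
    then show "((\<lambda>t::real. 2 * E_max * inverse (t\<^sup>2)) \<longlongrightarrow> 0) at_top" by simp
  qed simp
  then show ?thesis by (simp add: LIM_zero_iff)
qed

section \<open>Convergence of the distance to a minimiser\<close>

definition "R = (1 + 2 / (lam * c)) * E_max"

lemma norm_le_R: "t \<ge> T \<Longrightarrow> norm (x t - z) \<le> R"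
proof -
  assume t: "t \<ge> T"
  have "(1 + 2 / (lam * c)) * (1 + E t) \<le> R"
    unfolding R_def using E_le[OF t] lam_pos c_pos by (intro mult_left_mono) auto
  then show ?thesis using norm_bounds_E(2)[OF t] by simp
qed

lemma R_nonneg: "0 \<le> R"
  by (rule order_trans[OF norm_ge_zero norm_le_R[of T]]) simp

text \<open>One constant for both uses of the domination criterion below; its summands are those
  that arise when \<open>q'\<close> is estimated in \<open>distance_tendsto\<close>.\<close>

definition "C = 1 / c + \<beta> / (2 * c) + 2 + 2 / c + R"

lemma C_ge: "1 / c + \<beta> / (2 * c) + 2 + 2 / c \<le> C" "2 / c \<le> C" "R \<le> C" "0 \<le> C"
proof -
  have "0 \<le> 1 / c" "0 \<le> \<beta> / (2 * c)" "0 \<le> 2 / c" using c_pos beta by simp_all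
  then show "1 / c + \<beta> / (2 * c) + 2 + 2 / c \<le> C" "2 / c \<le> C" "R \<le> C" "0 \<le> C"
    using R_nonneg unfolding C_def by linarith+
qed

text \<open>The comparison function is \<open>C\<close> times
  \<open>- exp (K * A_max) * W + A\<close>: its derivative dominates
  \<open>D t + t * norm (e t)\<close> up to the factor \<open>C\<close>, and it is bounded above as
  \<open>W \<ge> 0\<close>.\<close>

lemma dominated_by_W_plus_A_tendsto:
  assumes F: "\<And>t. t > T \<Longrightarrow> (F has_real_derivative F' t) (at t)"
    and F': "\<And>t. t \<ge> T \<Longrightarrow> \<bar>F' t\<bar> \<le> C * (D t + t * norm (e t))"
  shows "\<exists>L. (F \<longlongrightarrow> L) at_top"
proof (rule dominated_deriv_tendsto)
  \<comment> \<open>Starting at \<open>T + 1\<close> leaves room for an \<open>F\<close> that is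
    differentiable only strictly after \<open>T\<close>, such as an integral with lower end
    \<open>T\<close>.\<close>
  fix t assume t: "T + 1 \<le> t"
  then have t': "t \<ge> T" "t > T" "t > t0" using T_ge by auto
  show "(F has_real_derivative F' t) (at t)" by (rule F[OF t'(2)])
  show "((\<lambda>t. C * (- exp (K * A_max) * W t + A t)) has_real_derivative
      C * (- exp (K * A_max) * W' t + t * norm (e t))) (at t)"
    by (intro DERIV_cmult DERIV_add W_deriv A_deriv t')
  show "\<bar>F' t\<bar> \<le> C * (- exp (K * A_max) * W' t + t * norm (e t))"
    using W'_le[OF t'(1)] C_ge(4) by (intro order_trans[OF F'[OF t'(1)]] mult_left_mono) auto
  have "0 \<le> W t" using E_nonneg[OF t'(1)] by (simp add: W_def)
  then have "0 \<le> exp (K * A_max) * W t" by simp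
  then show "C * (- exp (K * A_max) * W t + A t) \<le> C * A_max"
    using A_bounds[OF t'(3)] C_ge(4) by (intro mult_left_mono) auto
qed

lemma inner_g_le:
  assumes "t \<ge> T"
  shows "\<bar>inner (x t - z) (g t)\<bar> \<le> P t + R * norm (e t)"
proof -
  have "inner (x t - z) (g t) = P t + inner (x t - z) (e t)"
    by (simp add: P_def g_def inner_simps inner_commute)
  moreover have "\<bar>inner (x t - z) (e t)\<bar> \<le> R * norm (e t)"
    using Cauchy_Schwarz_ineq2[of "x t - z" "e t"] norm_le_R[OF assms]
    by (meson mult_right_mono norm_ge_zero order_trans)
  ultimately show ?thesis using P_nonneg[of t] by linarith
qed

lemma t_inner_g_le:
  assumes "t \<ge> T"
  shows "t * \<bar>inner (x t - z) (g t)\<bar> \<le> 2 / c * D t + R * (t * norm (e t))"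
proof -
  have t: "t > 0" using assms T_ge by simp
  have "0 \<le> 2 * t * (norm (x' t))\<^sup>2 + 2 / c * (\<beta> / 4 * t\<^sup>2 * (norm (g t))\<^sup>2)"
    using c_pos beta t by simp
  also have "\<dots> = 2 / c * D t - t * P t"
    using c_pos by (simp add: D_def field_simps)
  finally have "t * P t \<le> 2 / c * D t" by simp
  moreover have "t * \<bar>inner (x t - z) (g t)\<bar> \<le> t * (P t + R * norm (e t))"
    using inner_g_le[OF assms] t by (intro mult_left_mono) auto
  ultimately show ?thesis by (simp add: algebra_simps)
qed

lemma distance_tendsto: "\<exists>L. ((\<lambda>t. norm (x t - z)) \<longlongrightarrow> L) at_top"
proof -
  \<comment> \<open>With \<open>h = (norm (x - z))\<^sup>2 / 2\<close> and \<open>p\<close> an antiderivative of \<open>\<beta> * inner (x - z) g\<close>, the function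
    \<open>H = h + p\<close> satisfies \<open>t * H' + (\<alpha> - 1) * H = q + (\<alpha> - 1) * p\<close>, whose right-hand side converges.\<close>
  define h where "h t = inner (x t - z) (x t - z) / 2" for t
  define h' where "h' t = inner (x t - z) (x' t)" for t
  define q where "q t = t * h' t + (\<alpha> - 1) * h t + \<beta> * (t * inner (x t - z) (g t))" for t
  define q' where "q' t = t * (norm (x' t))\<^sup>2 + (\<beta> - t) * inner (x t - z) (g t)
    + \<beta> * (t * inner (x' t) (g t))" for t
  define p where "p t = integral {T..t} (\<lambda>s. \<beta> * inner (x s - z) (g s))" for t
  have y: "((\<lambda>s. x s - z) has_vector_derivative x' t) (at t)" if "t > t0" for t
    using x_deriv[OF that] by (auto intro!: derivative_eq_intros)
  have yg: "((\<lambda>s. inner (x s - z) (g s)) has_real_derivative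
      inner (x t - z) (g' t) + inner (x' t) (g t)) (at t)" if "t > t0" for t
    by (intro has_real_derivative_inner y g_deriv that)
  have h: "(h has_real_derivative h' t) (at t)" if "t > t0" for t
    using DERIV_cdivide[OF has_real_derivative_inner[OF y[OF that] y[OF that]], of 2]
    by (simp add: h_def[abs_def] h'_def inner_commute)
  \<comment> \<open>The weights in \<open>q\<close> make both \<open>h'\<close> and
    \<open>g'\<close> drop out of the derivative once the equation is inserted; every remaining term
    is controlled by \<open>D\<close> and \<open>e\<close>.\<close>
  have q: "(q has_real_derivative q' t) (at t)" if t: "t > t0" for t
  proof -
    have tp: "t > 0" using t t0_pos by simp
    have xx: "t *\<^sub>R x'' t = - \<alpha> *\<^sub>R x' t - (t * \<beta>) *\<^sub>R g' t - t *\<^sub>R g t"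
    proof -
      have "x'' t = - (\<alpha> / t) *\<^sub>R x' t - \<beta> *\<^sub>R g' t - g t"
        using ode[OF t] by (simp add: algebra_simps eq_neg_iff_add_eq_0)
      then have "t *\<^sub>R x'' t = t *\<^sub>R (- (\<alpha> / t) *\<^sub>R x' t - \<beta> *\<^sub>R g' t - g t)" by simp
      then show ?thesis using tp by (simp add: scaleR_diff_right)
    qed
    have "(q has_real_derivative (1 * h' t + (inner (x t - z) (x'' t) + inner (x' t) (x' t)) * t)
        + (\<alpha> - 1) * h' t + \<beta> * (1 * inner (x t - z) (g t)
        + (inner (x t - z) (g' t) + inner (x' t) (g t)) * t)) (at t)"
      unfolding q_def[abs_def] h'_def[abs_def]
      by (intro DERIV_add DERIV_cmult DERIV_mult DERIV_ident yg t h[unfolded h'_def]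
        has_real_derivative_inner y x'_deriv)
    also have "(1 * h' t + (inner (x t - z) (x'' t) + inner (x' t) (x' t)) * t)
        + (\<alpha> - 1) * h' t + \<beta> * (1 * inner (x t - z) (g t)
        + (inner (x t - z) (g' t) + inner (x' t) (g t)) * t) = q' t"
    proof -
      have "t * inner (x t - z) (x'' t) = inner (x t - z) (t *\<^sub>R x'' t)" by simp
      also have "\<dots> = - \<alpha> * h' t - t * \<beta> * inner (x t - z) (g' t) - t * inner (x t - z) (g t)"
        unfolding xx by (simp add: h'_def inner_diff_right)
      finally show ?thesis by (simp add: q'_def power2_norm_eq_inner algebra_simps)
    qed
    finally show ?thesis .
  qed
  have p: "(p has_real_derivative \<beta> * inner (x t - z) (g t)) (at t)" if "t > T" for t
  proof -
    have "continuous_on {T..} (\<lambda>s. \<beta> * inner (x s - z) (g s))"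
      using T_ge(2)
      by (intro continuous_on_mult_left continuous_at_imp_continuous_on ballI DERIV_isCont[OF yg]) simp
    then have "(p has_real_derivative \<beta> * inner (x t - z) (g t)) (at t within {T..})"
      unfolding p_def[abs_def] using that by (intro integral_atLeast_has_real_derivative) auto
    then show ?thesis using that by (simp add: at_within_atLeast)
  qed
  have q'_le: "\<bar>q' t\<bar> \<le> C * (D t + t * norm (e t))" if t: "t \<ge> T" for t
  proof -
    have t': "t \<ge> 1" "\<beta> \<le> t" using t T_ge beta by auto
    define a b where "a = t * (norm (x' t))\<^sup>2" and "b = t * (norm (g t))\<^sup>2"
    have ab: "0 \<le> a" "0 \<le> b" using t' by (simp_all add: a_def b_def)
    have "b \<le> t\<^sup>2 * (norm (g t))\<^sup>2"
      unfolding b_def using t' by (intro mult_right_mono) (auto simp: power2_eq_square)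
    then have "\<beta> / 4 * b \<le> \<beta> / 4 * (t\<^sup>2 * (norm (g t))\<^sup>2)" using beta by (intro mult_left_mono) auto
    moreover have "0 \<le> c / 2 * t * P t" "0 \<le> c * a" "0 \<le> \<beta> / 4 * (t\<^sup>2 * (norm (g t))\<^sup>2)"
      using c_pos t' P_nonneg ab beta by simp_all
    ultimately have "c * a \<le> D t" "\<beta> / 4 * b \<le> D t"
      unfolding D_def mult.assoc[of _ "t\<^sup>2"] mult.assoc[of c t] a_def[symmetric] by linarith+
    then have 1: "a \<le> 1 / c * D t" "b \<le> 4 / \<beta> * D t" using c_pos beta by (simp_all add: field_simps)
    \<comment> \<open>Young's inequality splits the cross term into the two squares bounded in
      \<open>1\<close>.\<close>
    have 2: "\<beta> * (t * \<bar>inner (x' t) (g t)\<bar>) \<le> \<beta> / (2 * c) * D t + 2 * D t"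
    proof -
      have "2 * \<bar>inner (x' t) (g t)\<bar> \<le> 2 * (norm (x' t) * norm (g t))"
        using Cauchy_Schwarz_ineq2[of "x' t" "g t"] by simp
      also have "\<dots> \<le> (norm (x' t))\<^sup>2 + (norm (g t))\<^sup>2"
        using sum_squares_bound[of "norm (x' t)" "norm (g t)"] by simp
      finally have "t * (2 * \<bar>inner (x' t) (g t)\<bar>) \<le> a + b"
        unfolding a_def b_def using t' by (simp add: distrib_left[symmetric])
      then have "\<beta> / 2 * (t * (2 * \<bar>inner (x' t) (g t)\<bar>)) \<le> \<beta> / 2 * (1 / c * D t + 4 / \<beta> * D t)"
        using 1 beta by (intro mult_left_mono) auto
      also have "\<dots> = \<beta> / (2 * c) * D t + 2 * D t" using beta by (simp add: field_simps)
      finally show ?thesis by simp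
    qed
    have "\<bar>\<beta> - t\<bar> * \<bar>inner (x t - z) (g t)\<bar> \<le> t * \<bar>inner (x t - z) (g t)\<bar>"
      using t' beta by (intro mult_right_mono) auto
    with t_inner_g_le[OF t]
    have 3: "\<bar>\<beta> - t\<bar> * \<bar>inner (x t - z) (g t)\<bar> \<le> 2 / c * D t + R * (t * norm (e t))" by simp
    have "\<bar>q' t\<bar> \<le> a + \<bar>\<beta> - t\<bar> * \<bar>inner (x t - z) (g t)\<bar> + \<beta> * (t * \<bar>inner (x' t) (g t)\<bar>)"
      unfolding q'_def a_def[symmetric] using ab t' beta
      by (intro order_trans[OF abs_triangle_ineq] add_mono) (auto simp: abs_mult)
    also have "\<dots> \<le> (1 / c + \<beta> / (2 * c) + 2 + 2 / c) * D t + R * (t * norm (e t))"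
      using 1 2 3 by (simp add: distrib_right)
    also have "\<dots> \<le> C * D t + C * (t * norm (e t))"
      using D_nonneg[OF t] t' by (intro add_mono mult_right_mono C_ge) auto
    finally show ?thesis by (simp add: distrib_left)
  qed
  obtain Lq where Lq: "(q \<longlongrightarrow> Lq) at_top"
    using dominated_by_W_plus_A_tendsto[OF q[OF less_trans[OF T_ge(2)]] q'_le] by blast
  have p'_le: "\<bar>\<beta> * inner (x t - z) (g t)\<bar> \<le> C * (D t + t * norm (e t))" if t: "t \<ge> T" for t
  proof -
    have t': "t \<ge> 1" "\<beta> \<le> t" using t T_ge beta by auto
    have "\<bar>\<beta> * inner (x t - z) (g t)\<bar> \<le> t * \<bar>inner (x t - z) (g t)\<bar>"
      using t' beta by (simp add: abs_mult mult_right_mono)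
    also have "\<dots> \<le> 2 / c * D t + R * (t * norm (e t))" by (rule t_inner_g_le[OF t])
    also have "\<dots> \<le> C * D t + C * (t * norm (e t))"
      using D_nonneg[OF t] t' by (intro add_mono mult_right_mono C_ge) auto
    finally show ?thesis by (simp add: distrib_left)
  qed
  obtain Lp where Lp: "(p \<longlongrightarrow> Lp) at_top"
    using dominated_by_W_plus_A_tendsto[OF p p'_le] by blast
  have "((\<lambda>t. h t + p t) \<longlongrightarrow> (Lq + (\<alpha> - 1) * Lp) / (\<alpha> - 1)) at_top"
  proof (rule euler_operator_tendsto)
    show "0 < \<alpha> - 1" using alpha by simp
    show "((\<lambda>t. h t + p t) has_real_derivative h' t + \<beta> * inner (x t - z) (g t)) (at t)"
      if "T + 1 \<le> t" for t
      using that T_ge(2) by (intro DERIV_add h p) auto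
    have "((\<lambda>t. q t + (\<alpha> - 1) * p t) \<longlongrightarrow> Lq + (\<alpha> - 1) * Lp) at_top"
      by (intro tendsto_intros Lq Lp)
    then show "((\<lambda>t. t * (h' t + \<beta> * inner (x t - z) (g t)) + (\<alpha> - 1) * (h t + p t))
        \<longlongrightarrow> Lq + (\<alpha> - 1) * Lp) at_top"
      by (simp add: q_def algebra_simps)
  qed
  from tendsto_diff[OF this Lp] obtain L where "(h \<longlongrightarrow> L) at_top" by auto
  then have "((\<lambda>t. sqrt (2 * h t)) \<longlongrightarrow> sqrt (2 * L)) at_top"
    by (intro tendsto_intros)
  then show ?thesis by (auto simp: h_def norm_eq_sqrt_inner)
qed

end

section \<open>Pointwise bound on the perturbation and conclusion\<close>

text \<open>The derivative of \<open>s *\<^sub>R e s\<close> is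
  \<open>s *\<^sub>R e' s + e s\<close>, and \<open>norm (e s) \<le> s * norm (e s) / t0\<close> for
  \<open>s \<ge> t0\<close>. Its norm is thus at most the derivative of the bounded function
  \<open>A / t0 + B\<close>.\<close>

lemma scaled_perturbation_bounded:
  fixes e e' :: "real \<Rightarrow> 'a::real_normed_vector"
  assumes t0: "t0 > 0"
    and e: "\<And>t. t \<ge> t0 \<Longrightarrow> (e has_vector_derivative e' t) (at t within {t0..})"
    and A: "\<And>t. t \<ge> t0 \<Longrightarrow> (A has_real_derivative t * norm (e t)) (at t within {t0..})"
    and B: "\<And>t. t \<ge> t0 \<Longrightarrow> (B has_real_derivative t * norm (e' t)) (at t within {t0..})"
    and A_bounds: "\<And>t. t \<ge> t0 \<Longrightarrow> 0 \<le> A t \<and> A t \<le> A_max"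
    and B_bounds: "\<And>t. t \<ge> t0 \<Longrightarrow> 0 \<le> B t \<and> B t \<le> B_max"
    and t: "t > t0"
  shows "t * norm (e t) \<le> t0 * norm (e t0) + A_max / t0 + B_max"
proof -
  define \<phi> where "\<phi> s = A s / t0 + B s" for s
  have e1: "((\<lambda>s. s *\<^sub>R e s) has_vector_derivative s *\<^sub>R e' s + 1 *\<^sub>R e s) (at s within {t0..})"
    if "s \<ge> t0" for s
    by (intro has_vector_derivative_scaleR e that DERIV_ident)
  have \<phi>1: "(\<phi> has_real_derivative s * norm (e s) / t0 + s * norm (e' s)) (at s within {t0..})"
    if "s \<ge> t0" for s
    unfolding \<phi>_def[abs_def] by (intro DERIV_add DERIV_cdivide A B that)
  have "norm (t *\<^sub>R e t - t0 *\<^sub>R e t0) \<le> \<phi> t - \<phi> t0"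
  proof (rule differentiable_bound_general[OF t])
    show "continuous_on {t0..t} (\<lambda>s. s *\<^sub>R e s)"
      by (rule continuous_on_subset[of "{t0..}"])
        (auto simp: continuous_on_eq_continuous_within intro!: has_vector_derivative_continuous e1)
    show "continuous_on {t0..t} \<phi>"
      by (rule continuous_on_subset[of "{t0..}"])
        (auto simp: continuous_on_eq_continuous_within intro!: DERIV_continuous \<phi>1)
    fix s assume s: "t0 < s" "s < t"
    show "((\<lambda>s. s *\<^sub>R e s) has_vector_derivative s *\<^sub>R e' s + 1 *\<^sub>R e s) (at s)"
      using e1[of s] s by (simp add: at_within_atLeast)
    show "(\<phi> has_vector_derivative s * norm (e s) / t0 + s * norm (e' s)) (at s)"
      using \<phi>1[of s] s by (simp add: at_within_atLeast has_real_derivative_iff_has_vector_derivative)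
    have "1 * norm (e s) \<le> s / t0 * norm (e s)"
      using s t0 by (intro mult_right_mono) auto
    moreover have "norm (s *\<^sub>R e' s + 1 *\<^sub>R e s) \<le> s * norm (e' s) + norm (e s)"
      using norm_triangle_ineq[of "s *\<^sub>R e' s" "e s"] s t0 by simp
    ultimately show "norm (s *\<^sub>R e' s + 1 *\<^sub>R e s) \<le> s * norm (e s) / t0 + s * norm (e' s)"
      by simp
  qed
  moreover have "norm (t *\<^sub>R e t) \<le> norm (t0 *\<^sub>R e t0) + norm (t *\<^sub>R e t - t0 *\<^sub>R e t0)"
    by (rule norm_triangle_sub)
  moreover have "\<phi> t - \<phi> t0 \<le> A_max / t0 + B_max"
  proof -
    have "0 \<le> A t0 / t0" "A t / t0 \<le> A_max / t0"
      using A_bounds[of t] A_bounds[of t0] t t0 by (auto intro: divide_right_mono)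
    then show ?thesis using B_bounds[of t] B_bounds[of t0] t by (simp add: \<phi>_def)
  qed
  ultimately show ?thesis using t t0 by simp
qed

theorem theorem6:
  fixes f :: "'a::{real_inner, complete_space} \<Rightarrow> real"
    and gradf :: "'a \<Rightarrow> 'a"
    and hessf :: "'a \<Rightarrow> 'a \<Rightarrow>\<^sub>L 'a"
    and e e' x x' x'' :: "real \<Rightarrow> 'a"
    and t0 \<alpha> \<beta> :: real
  assumes t0_pos: "t0 > 0"
    and f_grad: "\<And>y. (f has_derivative (\<lambda>h. inner (gradf y) h)) (at y)"
    and f_hess: "\<And>y. (gradf has_derivative blinfun_apply (hessf y)) (at y)"
    and hess_cont: "continuous_on UNIV hessf"
    and f_convex: "convex_on UNIV f"
    and argmin_nonempty: "\<exists>z. \<forall>y. f z \<le> f y"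
    and e_deriv: "\<And>t. t \<ge> t0 \<Longrightarrow> (e has_vector_derivative e' t) (at t within {t0..})"
    and e'_cont: "continuous_on {t0..} e'"
    and e_int: "(\<lambda>t. t * norm (e t)) integrable_on {t0..}"
    and e'_int: "(\<lambda>t. t * norm (e' t)) integrable_on {t0..}"
    and alpha: "\<alpha> > 3"
    and beta: "\<beta> > 0"
    and x_deriv: "\<And>t. t \<ge> t0 \<Longrightarrow> (x has_vector_derivative x' t) (at t within {t0..})"
    and x'_deriv: "\<And>t. t \<ge> t0 \<Longrightarrow> (x' has_vector_derivative x'' t) (at t within {t0..})"
    and ode: "\<And>t. t \<ge> t0 \<Longrightarrow>
       x'' t + (\<alpha> / t) *\<^sub>R x' t
       + \<beta> *\<^sub>R vector_derivative (\<lambda>s. gradf (x s) + e s) (at t within {t0..})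
       + gradf (x t) + e t = 0"
  shows "\<exists>z. (\<forall>y. f z \<le> f y) \<and> weakly_tendsto x z at_top"
proof -
  have e_cont: "continuous_on {t0..} e"
    by (auto simp: continuous_on_eq_continuous_within intro!: has_vector_derivative_continuous e_deriv)
  obtain A A_max where A: "\<And>t. t0 \<le> t \<Longrightarrow> (A has_real_derivative t * norm (e t)) (at t within {t0..})"
    and A_bounds: "\<And>t. t0 \<le> t \<Longrightarrow> 0 \<le> A t \<and> A t \<le> A_max"
    by (rule bounded_antiderivative[OF _ _ e_int])
      (use t0_pos e_cont in \<open>auto intro!: continuous_intros\<close>)
  obtain B B_max where B: "\<And>t. t0 \<le> t \<Longrightarrow> (B has_real_derivative t * norm (e' t)) (at t within {t0..})"
    and B_bounds: "\<And>t. t0 \<le> t \<Longrightarrow> 0 \<le> B t \<and> B t \<le> B_max"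
    by (rule bounded_antiderivative[OF _ _ e'_int])
      (use t0_pos e'_cont in \<open>auto intro!: continuous_intros\<close>)
  have g_deriv: "((\<lambda>s. gradf (x s) + e s) has_vector_derivative hessf (x t) (x' t) + e' t) (at t)"
    if "t > t0" for t
  proof -
    have "(x has_derivative (\<lambda>s. s *\<^sub>R x' t)) (at t)"
      using x_deriv[of t] that by (simp add: has_vector_derivative_def at_within_atLeast)
    from has_derivative_compose[OF this f_hess]
    have "((\<lambda>s. gradf (x s)) has_vector_derivative hessf (x t) (x' t)) (at t)"
      by (simp add: has_vector_derivative_def blinfun.scaleR_right)
    then show ?thesis
      using e_deriv[of t] that by (intro has_vector_derivative_add) (auto simp: at_within_atLeast)
  qed
  \<comment> \<open>The instance is available for every minimiser \<open>z\<close>, with the same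
    \<open>A\<close> and the same bounds: the distances must converge for all of them.\<close>
  have traj: "perturbed_trajectory f gradf e (\<lambda>s. gradf (x s) + e s)
      (\<lambda>t. hessf (x t) (x' t) + e' t) x x' x'' A t0 \<alpha> \<beta> A_max
      (t0 * norm (e t0) + A_max / t0 + B_max) z" if "\<forall>y. f z \<le> f y" for z
  proof
    fix t assume t: "t0 < t"
    show "(x has_vector_derivative x' t) (at t)" "(x' has_vector_derivative x'' t) (at t)"
      "(A has_real_derivative t * norm (e t)) (at t)"
      using x_deriv[of t] x'_deriv[of t] A[of t] t by (simp_all add: at_within_atLeast)
    show "0 \<le> A t \<and> A t \<le> A_max" using A_bounds t by simp
    \<comment> \<open>At interior times the derivative within the half-line is the two-sided one,
      given explicitly by \<open>g_deriv\<close>.\<close>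
    show "x'' t + (\<alpha> / t) *\<^sub>R x' t + \<beta> *\<^sub>R (hessf (x t) (x' t) + e' t) + (gradf (x t) + e t) = 0"
      using ode[of t] t vector_derivative_at[OF g_deriv[OF t]]
      by (simp add: at_within_atLeast add.assoc)
    show "t * norm (e t) \<le> t0 * norm (e t0) + A_max / t0 + B_max"
      using t0_pos e_deriv A B A_bounds B_bounds t by (rule scaled_perturbation_bounded)
  qed (use t0_pos alpha beta f_grad f_convex that g_deriv in auto)
  obtain z0 where z0: "\<forall>y. f z0 \<le> f y" using argmin_nonempty by blast
  show ?thesis
  proof (rule opial_convex_minimizers)
    show "continuous_on UNIV f"
      using f_grad by (meson has_derivative_continuous continuous_at_imp_continuous_on)
    show "\<exists>L. ((\<lambda>t. norm (x t - z)) \<longlongrightarrow> L) at_top" if "\<forall>y. f z \<le> f y" for z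
      using perturbed_trajectory.distance_tendsto[OF traj[OF that]] .
    show "((\<lambda>t. f (x t)) \<longlongrightarrow> f z0) at_top"
      using perturbed_trajectory.values_tendsto[OF traj[OF z0]] .
  qed (use f_convex z0 in auto)
qed

end
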